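(* Let $X$ be a locally compact topological space. Then each of the spaces $\mathcal{F}(X)$, $\mathcal{F}'(X)$, $\mathcal{L}(X)$ and $\mathcal{L}'(X)$, equipped with the topology $\tau_w$ (on the last three, the subspace topology inherited from $(\mathcal{F}(X),\tau_w)$), is locally compact.
   Context: No separation axioms are assumed on topological spaces. Compact means that every open cover has a finite subcover (Hausdorff is not required). A topological space is locally compact if each of its points has a fundamental system of compact neighbourhoods. For a topological space $X$, $\mathcal{F}(X)$ is the set of all closed subsets of $X$ (including $\emptyset$) and $\mathcal{F}'(X)$ is the set of all nonempty closed subsets. A subset $L\subset X$ is a limit set if there is a net in $X$ that converges to every point of $L$; equivalently, every finite family of open subsets of $X$ each of which intersects $L$ has nonempty intersection. $\mathcal{L}(X)$ is the set of all closed limit sets of $X$, and $\mathcal{L}'(X)=\mathcal{L}(X)\cap\mathcal{F}'(X)$. The topology $\tau_w$ (lower semifinite topology) on $\mathcal{F}(X)$ is the one having as a base the sets $\mathcal{U}(\emptyset,\Phi)=\{A\in\mathcal{F}(X)\mid A\cap O\neq\emptyset \text{ for all } O\in\Phi\}$, where $\Phi$ runs through all finite (possibly empty) families of open subsets of $X$. *)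

theory Defs
  imports "HOL-Analysis.Analysis"
begin

definition directed_by :: "'i set \<Rightarrow> ('i \<times> 'i) set \<Rightarrow> bool"
  where "directed_by D r \<longleftrightarrow>
    D \<noteq> {} \<and> (\<forall>i\<in>D. (i, i) \<in> r) \<and>
    (\<forall>i\<in>D. \<forall>j\<in>D. \<forall>k\<in>D. (i, j) \<in> r \<and> (j, k) \<in> r \<longrightarrow> (i, k) \<in> r) \<and>
    (\<forall>i\<in>D. \<forall>j\<in>D. \<exists>k\<in>D. (i, k) \<in> r \<and> (j, k) \<in> r)"

definition net_in :: "'a topology \<Rightarrow> 'i set \<Rightarrow> ('i \<times> 'i) set \<Rightarrow> ('i \<Rightarrow> 'a) \<Rightarrow> bool"
  where "net_in X D r s \<longleftrightarrow> directed_by D r \<and> (\<forall>i\<in>D. s i \<in> topspace X)"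

definition net_converges_to ::
    "'a topology \<Rightarrow> 'i set \<Rightarrow> ('i \<times> 'i) set \<Rightarrow> ('i \<Rightarrow> 'a) \<Rightarrow> 'a \<Rightarrow> bool"
  where "net_converges_to X D r s x \<longleftrightarrow>
    x \<in> topspace X \<and>
    (\<forall>U. openin X U \<and> x \<in> U \<longrightarrow> (\<exists>i\<in>D. \<forall>j\<in>D. (i, j) \<in> r \<longrightarrow> s j \<in> U))"

text \<open>
  HOL cannot quantify existentially over the index type of a net, so the definition of a limit set
  fixes it. This is no restriction: by \<open>net_imp_limit_set_in\<close> below a net over any index type may be
  used. The equivalence with the finite intersection condition is \<open>limit_set_in_iff\<close>; there the
  intersection of the empty family is the whole space, so the empty set is a limit set exactly
  when the space is nonempty, in agreement with the definition by nets.
\<close>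

definition limit_set_in :: "'a topology \<Rightarrow> 'a set \<Rightarrow> bool"
  where "limit_set_in X L \<longleftrightarrow>
    L \<subseteq> topspace X \<and>
    (\<exists>(D :: 'a set set set) r s. net_in X D r s \<and> (\<forall>x\<in>L. net_converges_to X D r s x))"

lemma net_imp_finite_intersections:
  fixes D :: "'i set"
  assumes net: "net_in X D r s" and conv: "\<And>x. x \<in> L \<Longrightarrow> net_converges_to X D r s x"
    and "finite \<Phi>" and "\<And>U. U \<in> \<Phi> \<Longrightarrow> openin X U \<and> U \<inter> L \<noteq> {}"
  shows "topspace X \<inter> \<Inter>\<Phi> \<noteq> {}"
proof -
  have dir: "directed_by D r" and sX: "\<And>i. i \<in> D \<Longrightarrow> s i \<in> topspace X"
    using net by (auto simp: net_in_def)
  have "\<exists>i\<in>D. \<forall>j\<in>D. (i, j) \<in> r \<longrightarrow> s j \<in> \<Inter>\<Phi>"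
    using assms(3,4)
  proof (induction \<Phi>)
    case empty
    obtain i where "i \<in> D" using dir unfolding directed_by_def by blast
    then show ?case by (intro bexI[of _ i]) simp_all
  next
    case (insert U \<Phi>)
    obtain i where i: "i \<in> D" "\<And>j. j \<in> D \<Longrightarrow> (i, j) \<in> r \<Longrightarrow> s j \<in> \<Inter>\<Phi>"
      using insert.IH[OF insert.prems] by (meson insertI2)
    obtain x where x: "x \<in> L" "x \<in> U" and U: "openin X U"
      using insert.prems[of U] by blast
    obtain i' where i': "i' \<in> D" "\<And>j. j \<in> D \<Longrightarrow> (i', j) \<in> r \<Longrightarrow> s j \<in> U"
      using conv[OF x(1)] U x(2) unfolding net_converges_to_def by meson
    obtain k where k: "k \<in> D" "(i, k) \<in> r" "(i', k) \<in> r"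
      using dir i(1) i'(1) unfolding directed_by_def by meson
    have "s j \<in> \<Inter>(insert U \<Phi>)" if j: "j \<in> D" "(k, j) \<in> r" for j
    proof -
      have trans: "(a, c) \<in> r"
        if "a \<in> D" "b \<in> D" "c \<in> D" "(a, b) \<in> r" "(b, c) \<in> r" for a b c
        using dir that unfolding directed_by_def by blast
      have "(i, j) \<in> r" "(i', j) \<in> r"
        using trans[OF i(1) k(1) j(1) k(2) j(2)] trans[OF i'(1) k(1) j(1) k(3) j(2)] .
      then show ?thesis using i(2) i'(2) j(1) by auto
    qed
    then show ?case using k(1) by blast
  qed
  then obtain i where i: "i \<in> D" "\<forall>j\<in>D. (i, j) \<in> r \<longrightarrow> s j \<in> \<Inter>\<Phi>" by (rule bexE)
  have "(i, i) \<in> r" using dir i(1) unfolding directed_by_def by blast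
  then have "i \<in> D" "s i \<in> \<Inter>\<Phi>" using i by blast+
  then show ?thesis using sX by blast
qed

lemma finite_intersections_imp_limit_set_in:
  fixes X :: "'a topology"
  assumes L: "L \<subseteq> topspace X"
    and fip: "\<And>\<Phi>. finite \<Phi> \<Longrightarrow> (\<And>U. U \<in> \<Phi> \<Longrightarrow> openin X U \<and> U \<inter> L \<noteq> {})
                \<Longrightarrow> topspace X \<inter> \<Inter>\<Phi> \<noteq> {}"
  shows "limit_set_in X L"
proof -
  define D where "D = {\<Phi>. finite \<Phi> \<and> (\<forall>U\<in>\<Phi>. openin X U \<and> U \<inter> L \<noteq> {})}"
  define r where "r = {(\<Phi>, \<Psi>). \<Phi> \<subseteq> (\<Psi> :: 'a set set)}"
  define s where "s \<Phi> = (SOME x. x \<in> topspace X \<inter> \<Inter>\<Phi>)" for \<Phi>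
  have s: "s \<Phi> \<in> topspace X \<inter> \<Inter>\<Phi>" if "\<Phi> \<in> D" for \<Phi>
  proof -
    have "topspace X \<inter> \<Inter>\<Phi> \<noteq> {}"
      using that by (intro fip) (auto simp: D_def)
    then show ?thesis unfolding s_def by (rule iffD2[OF some_in_eq])
  qed
  have "{} \<in> D" by (simp add: D_def)
  moreover have "\<exists>k\<in>D. (i, k) \<in> r \<and> (j, k) \<in> r" if "i \<in> D" "j \<in> D" for i j
    using that by (intro bexI[of _ "i \<union> j"]) (auto simp: D_def r_def)
  ultimately have "directed_by D r"
    unfolding directed_by_def by (auto simp: r_def)
  then have net: "net_in X D r s"
    using s by (auto simp: net_in_def)
  have conv: "net_converges_to X D r s x" if x: "x \<in> L" for x
    unfolding net_converges_to_def
  proof (intro conjI allI impI)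
    show "x \<in> topspace X" using x L by blast
  next
    fix U assume U: "openin X U \<and> x \<in> U"
    have "{U} \<in> D" using U x by (auto simp: D_def)
    moreover have "s j \<in> U" if "j \<in> D" "({U}, j) \<in> r" for j
      using s[OF that(1)] that(2) by (auto simp: r_def)
    ultimately show "\<exists>i\<in>D. \<forall>j\<in>D. (i, j) \<in> r \<longrightarrow> s j \<in> U" by blast
  qed
  show ?thesis unfolding limit_set_in_def using L net conv by blast
qed

lemma limit_set_in_iff:
  "limit_set_in X L \<longleftrightarrow>
    L \<subseteq> topspace X \<and>
    (\<forall>\<Phi>. finite \<Phi> \<and> (\<forall>U\<in>\<Phi>. openin X U \<and> U \<inter> L \<noteq> {}) \<longrightarrow> topspace X \<inter> \<Inter>\<Phi> \<noteq> {})"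
  (is "?lhs \<longleftrightarrow> ?rhs")
proof
  assume l: ?lhs
  then obtain D :: "'a set set set" and r s
    where "L \<subseteq> topspace X" "net_in X D r s" "\<And>x. x \<in> L \<Longrightarrow> net_converges_to X D r s x"
    unfolding limit_set_in_def by blast
  then show ?rhs using net_imp_finite_intersections[of X D r s L] by simp
next
  assume r: ?rhs
  show ?lhs
  proof (rule finite_intersections_imp_limit_set_in)
    show "L \<subseteq> topspace X" using r by (rule conjunct1)
    show "topspace X \<inter> \<Inter>\<Phi> \<noteq> {}"
      if "finite \<Phi>" "\<And>U. U \<in> \<Phi> \<Longrightarrow> openin X U \<and> U \<inter> L \<noteq> {}" for \<Phi>
      using conjunct2[OF r] that by simp
  qed
qed

lemma net_imp_limit_set_in:
  fixes D :: "'i set"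
  assumes "L \<subseteq> topspace X" "net_in X D r s" "\<And>x. x \<in> L \<Longrightarrow> net_converges_to X D r s x"
  shows "limit_set_in X L"
  using assms(1) net_imp_finite_intersections[OF assms(2,3)]
  by (rule finite_intersections_imp_limit_set_in)

definition closed_sets :: "'a topology \<Rightarrow> 'a set set"
  where "closed_sets X = {A. closedin X A}"

definition nonempty_closed_sets :: "'a topology \<Rightarrow> 'a set set"
  where "nonempty_closed_sets X = {A. closedin X A \<and> A \<noteq> {}}"

definition closed_limit_sets :: "'a topology \<Rightarrow> 'a set set"
  where "closed_limit_sets X = {A. closedin X A \<and> limit_set_in X A}"

definition nonempty_closed_limit_sets :: "'a topology \<Rightarrow> 'a set set"
  where "nonempty_closed_limit_sets X = closed_limit_sets X \<inter> nonempty_closed_sets X"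

definition hitting_closed_sets :: "'a topology \<Rightarrow> 'a set set \<Rightarrow> 'a set set"
  where "hitting_closed_sets X \<Phi> = {A \<in> closed_sets X. \<forall>U\<in>\<Phi>. A \<inter> U \<noteq> {}}"

definition lower_semifinite_base :: "'a topology \<Rightarrow> 'a set set \<Rightarrow> bool"
  where "lower_semifinite_base X \<U> \<longleftrightarrow>
    (\<exists>\<Phi>. finite \<Phi> \<and> (\<forall>U\<in>\<Phi>. openin X U) \<and> \<U> = hitting_closed_sets X \<Phi>)"

definition lower_semifinite_topology :: "'a topology \<Rightarrow> 'a set topology"
  where "lower_semifinite_topology X = topology (arbitrary union_of lower_semifinite_base X)"

lemma openin_lower_semifinite_topology:
  "openin (lower_semifinite_topology X) = arbitrary union_of lower_semifinite_base X"
proof -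
  have "lower_semifinite_base X (S \<inter> T)"
    if S: "lower_semifinite_base X S" and T: "lower_semifinite_base X T" for S T
  proof -
    obtain \<Phi> \<Psi> where "finite \<Phi>" "\<forall>U\<in>\<Phi>. openin X U" "S = hitting_closed_sets X \<Phi>"
      "finite \<Psi>" "\<forall>U\<in>\<Psi>. openin X U" "T = hitting_closed_sets X \<Psi>"
      using S T unfolding lower_semifinite_base_def by blast
    then show ?thesis
      unfolding lower_semifinite_base_def
      by (intro exI[of _ "\<Phi> \<union> \<Psi>"]) (auto simp: hitting_closed_sets_def)
  qed
  then show ?thesis
    unfolding lower_semifinite_topology_def
    by (intro topology_inverse' istopology_base)
qed

lemma topspace_lower_semifinite_topology:
  "topspace (lower_semifinite_topology X) = closed_sets X"
proof
  have "S \<subseteq> closed_sets X" if "lower_semifinite_base X S" for S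
    using that by (auto simp: lower_semifinite_base_def hitting_closed_sets_def)
  moreover have "(arbitrary union_of lower_semifinite_base X) (topspace (lower_semifinite_topology X))"
    using openin_topspace[of "lower_semifinite_topology X"]
    unfolding openin_lower_semifinite_topology .
  ultimately show "topspace (lower_semifinite_topology X) \<subseteq> closed_sets X"
    unfolding union_of_def by blast
next
  have "lower_semifinite_base X (closed_sets X)"
    unfolding lower_semifinite_base_def
    by (intro exI[of _ "{}"]) (simp add: hitting_closed_sets_def)
  then have "openin (lower_semifinite_topology X) (closed_sets X)"
    unfolding openin_lower_semifinite_topology by (simp add: union_of_inc arbitrary_def)
  then show "closed_sets X \<subseteq> topspace (lower_semifinite_topology X)"
    by (rule openin_subset)
qed

text \<open>
  The library's \<^const>\<open>locally_compact_space\<close> only asks for one compact neighbourhood of each point,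
  which is weaker for non-Hausdorff spaces.
\<close>

definition locally_compact_nbhds :: "'a topology \<Rightarrow> bool"
  where "locally_compact_nbhds X \<longleftrightarrow> neighbourhood_base_of (compactin X) X"

end

theory Submission
  imports Defs
begin

text \<open>
  A basic neighbourhood of a closed set \<open>A\<close> consists of the closed sets hitting open sets
  \<open>U\<^sub>1, \<dots>, U\<^sub>n\<close>. Choosing a compact neighbourhood \<open>K\<^sub>i \<subseteq> U\<^sub>i\<close> of some point of
  \<open>A \<inter> U\<^sub>i\<close>, one obtains the smaller neighbourhood of all closed sets hitting every \<open>K\<^sub>i\<close>. It is
  compact by Alexander's subbase theorem: if the sets hitting some \<open>U \<in> \<C>\<close> cover it, then the
  closed set \<open>X - \<Union>\<C>\<close>, which is not covered, must miss some \<open>K\<^sub>i\<close>, so finitely many members of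
  \<open>\<C>\<close> cover \<open>K\<^sub>i\<close>, and these already suffice. The other three spaces inherit the property since
  the limit sets form a closed subspace and the nonempty sets an open one.
\<close>

lemma locally_compact_nbhds_open_subset:
  assumes "locally_compact_nbhds X" "openin X S"
  shows "locally_compact_nbhds (subtopology X S)"
  unfolding locally_compact_nbhds_def neighbourhood_base_of
proof (intro allI impI, elim conjE)
  fix W x
  assume W: "openin (subtopology X S) W" and x: "x \<in> W"
  \<comment> \<open>Since \<open>S\<close> is open, \<open>W\<close> is open in \<open>X\<close>
    itself, and a compact neighbourhood chosen inside \<open>W\<close> automatically lies in
    \<open>S\<close>.\<close>
  have "openin X W" "W \<subseteq> S" using W assms(2) by (auto simp: openin_open_subtopology)
  then obtain U V where "openin X U" "compactin X V" "x \<in> U" "U \<subseteq> V" "V \<subseteq> W"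
    using assms(1) x unfolding locally_compact_nbhds_def neighbourhood_base_of by meson
  with \<open>W \<subseteq> S\<close> assms(2)
  show "\<exists>U V. openin (subtopology X S) U \<and> compactin (subtopology X S) V \<and> x \<in> U \<and> U \<subseteq> V \<and> V \<subseteq> W"
    by (intro exI[of _ U] exI[of _ V]) (auto simp: openin_open_subtopology compactin_subtopology)
qed

lemma locally_compact_nbhds_closed_subset:
  assumes "locally_compact_nbhds X" "closedin X S"
  shows "locally_compact_nbhds (subtopology X S)"
  unfolding locally_compact_nbhds_def neighbourhood_base_of
proof (intro allI impI, elim conjE)
  fix W x
  assume W: "openin (subtopology X S) W" and x: "x \<in> W"
  obtain T where T: "openin X T" "W = T \<inter> S" using W by (auto simp: openin_subtopology)
  then obtain U V where UV: "openin X U" "compactin X V" "x \<in> U" "U \<subseteq> V" "V \<subseteq> T"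
    using assms(1) x unfolding locally_compact_nbhds_def neighbourhood_base_of by (meson IntD1)
  \<comment> \<open>Here \<open>V\<close> may leave \<open>S\<close>; cutting it down to
    \<open>S\<close> keeps it compact because \<open>S\<close> is closed.\<close>
  have "compactin X (S \<inter> V)" using assms(2) UV(2) by (rule closed_Int_compactin)
  with T UV x
  show "\<exists>U V. openin (subtopology X S) U \<and> compactin (subtopology X S) V \<and> x \<in> U \<and> U \<subseteq> V \<and> V \<subseteq> W"
    by (intro exI[of _ "U \<inter> S"] exI[of _ "S \<inter> V"])
      (auto simp: compactin_subtopology openin_subtopology)
qed

lemma openin_hitting_closed_sets:
  assumes "finite \<Phi>" "\<And>U. U \<in> \<Phi> \<Longrightarrow> openin X U"
  shows "openin (lower_semifinite_topology X) (hitting_closed_sets X \<Phi>)"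
proof -
  have "lower_semifinite_base X (hitting_closed_sets X \<Phi>)"
    using assms unfolding lower_semifinite_base_def by blast
  then show ?thesis
    unfolding openin_lower_semifinite_topology by (rule arbitrary_union_of_inc)
qed

text \<open>Prepares Alexander's theorem: hitting a finite family means hitting each member, so the
  one-set conditions form a subbase. The whole of \<open>closed_sets X\<close> is added because the
  empty set hits nothing and would otherwise be left uncovered.\<close>

lemma lower_semifinite_base_eq_subbase:
  "lower_semifinite_base X =
    (finite intersection_of (\<lambda>S. S \<in> insert (closed_sets X) {hitting_closed_sets X {U} |U. openin X U})
      relative_to closed_sets X)"
    (is "_ = (finite intersection_of (\<lambda>S. S \<in> ?B) relative_to _)")
proof (intro ext iffI)
  fix S assume "lower_semifinite_base X S"
  then obtain \<Phi> where \<Phi>: "finite \<Phi>" "\<forall>U\<in>\<Phi>. openin X U" "S = hitting_closed_sets X \<Phi>"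
    unfolding lower_semifinite_base_def by blast
  have "(finite intersection_of (\<lambda>S. S \<in> ?B)) (\<Inter>((\<lambda>U. hitting_closed_sets X {U}) ` \<Phi>))"
    unfolding intersection_of_def using \<Phi>
    by (intro exI[of _ "(\<lambda>U. hitting_closed_sets X {U}) ` \<Phi>"]) auto
  \<comment> \<open>For empty \<open>\<Phi>\<close> the intersection is \<open>UNIV\<close>;
    restricting to \<open>closed_sets X\<close> gives the right value.\<close>
  moreover have "closed_sets X \<inter> \<Inter>((\<lambda>U. hitting_closed_sets X {U}) ` \<Phi>) = S"
    unfolding \<Phi>(3) by (auto simp: hitting_closed_sets_def)
  ultimately show "(finite intersection_of (\<lambda>S. S \<in> ?B) relative_to closed_sets X) S"
    unfolding relative_to_def by blast
next
  fix S assume "(finite intersection_of (\<lambda>S. S \<in> ?B) relative_to closed_sets X) S"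
  then obtain \<T> where \<T>: "finite \<T>" "\<T> \<subseteq> ?B" "S = closed_sets X \<inter> \<Inter>\<T>"
    unfolding relative_to_def intersection_of_def by blast
  have "lower_semifinite_base X (closed_sets X \<inter> \<Inter>\<T>)"
    using \<T>(1,2)
  proof (induction \<T>)
    case empty
    show ?case
      unfolding lower_semifinite_base_def
      by (intro exI[of _ "{}"]) (simp add: hitting_closed_sets_def)
  next
    case (insert S \<T>)
    then obtain \<Phi> where \<Phi>: "finite \<Phi>" "\<forall>U\<in>\<Phi>. openin X U"
      "closed_sets X \<inter> \<Inter>\<T> = hitting_closed_sets X \<Phi>"
      unfolding lower_semifinite_base_def by auto
    have eq: "closed_sets X \<inter> \<Inter>(insert S \<T>) = S \<inter> hitting_closed_sets X \<Phi>"
      using \<Phi>(3) by blast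
    consider "S = closed_sets X" | U where "openin X U" "S = hitting_closed_sets X {U}"
      using insert.prems by blast
    then show ?case
    proof cases
      case 1
      then show ?thesis unfolding eq lower_semifinite_base_def using \<Phi>(1,2)
        by (intro exI[of _ \<Phi>]) (auto simp: hitting_closed_sets_def)
    next
      case 2
      then show ?thesis unfolding eq lower_semifinite_base_def using \<Phi>(1,2)
        by (intro exI[of _ "insert U \<Phi>"]) (auto simp: hitting_closed_sets_def)
    qed
  qed
  then show "lower_semifinite_base X S" using \<T>(3) by simp
qed

text \<open>Alexander's theorem is applied to a subspace, so the subspace topology must itself be
  generated by the subbase. This works because restriction to a subset commutes with unions and
  nested restrictions collapse.\<close>

lemma subtopology_lower_semifinite_topology_eq_subbase:
  assumes "\<K> \<subseteq> closed_sets X"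
  shows "topology (arbitrary union_of (finite intersection_of
      (\<lambda>S. S \<in> insert (closed_sets X) {hitting_closed_sets X {U} |U. openin X U}) relative_to \<K>))
    = subtopology (lower_semifinite_topology X) \<K>"
    (is "topology (arbitrary union_of (?B relative_to \<K>)) = _")
proof -
  have "?B relative_to \<K> = lower_semifinite_base X relative_to \<K>"
    unfolding lower_semifinite_base_eq_subbase relative_to_relative_to
    using assms by (simp add: Int_absorb1)
  then have "openin (subtopology (lower_semifinite_topology X) \<K>)
      = arbitrary union_of (?B relative_to \<K>)"
    by (simp add: openin_relative_to[symmetric] openin_lower_semifinite_topology
        arbitrary_union_of_relative_to)
  then show ?thesis by (metis openin_inverse)
qed

lemma compactin_hitting_closed_sets:
  assumes "\<And>K. K \<in> \<Psi> \<Longrightarrow> compactin X K"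
  shows "compactin (lower_semifinite_topology X) (hitting_closed_sets X \<Psi>)"
proof -
  let ?K = "hitting_closed_sets X \<Psi>"
  let ?B = "insert (closed_sets X) {hitting_closed_sets X {U} |U. openin X U}"
  have sub: "?K \<subseteq> closed_sets X" by (auto simp: hitting_closed_sets_def)
  have "compact_space (subtopology (lower_semifinite_topology X) ?K)"
  proof (rule Alexander_subbase_alt)
    show "?K \<subseteq> \<Union>?B" using sub by blast
    show "topology (arbitrary union_of (finite intersection_of (\<lambda>S. S \<in> ?B) relative_to ?K))
        = subtopology (lower_semifinite_topology X) ?K"
      by (rule subtopology_lower_semifinite_topology_eq_subbase[OF sub])
  next
    fix \<C> assume \<C>: "\<C> \<subseteq> ?B" "?K \<subseteq> \<Union>\<C>"
    show "\<exists>\<C>'. finite \<C>' \<and> \<C>' \<subseteq> \<C> \<and> ?K \<subseteq> \<Union>\<C>'"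
    proof (cases "closed_sets X \<in> \<C>")
      case True
      with sub show ?thesis by (intro exI[of _ "{closed_sets X}"]) auto
    next
      case False
      \<comment> \<open>With the whole space excluded from \<open>\<C>\<close>, the cover is encoded
        by open subsets of \<open>X\<close>.\<close>
      define \<U> where "\<U> = {U. openin X U \<and> hitting_closed_sets X {U} \<in> \<C>}"
      have "closedin X (topspace X - \<Union>\<U>)" by (auto simp: \<U>_def)
      \<comment> \<open>A member of \<open>\<C>\<close> is given by some \<open>U\<close> in
        \<open>\<U>\<close>, and this closed set misses every such \<open>U\<close>.\<close>
      moreover have "topspace X - \<Union>\<U> \<notin> \<Union>\<C>"
        using \<C>(1) False by (fastforce simp: \<U>_def hitting_closed_sets_def)
      then have "topspace X - \<Union>\<U> \<notin> ?K" using \<C>(2) by (rule contra_subsetD[rotated])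
      ultimately obtain K where K: "K \<in> \<Psi>" "(topspace X - \<Union>\<U>) \<inter> K = {}"
        by (auto simp: hitting_closed_sets_def closed_sets_def)
      have "K \<subseteq> topspace X" using assms[OF K(1)] by (rule compactin_subset_topspace)
      with K have "K \<subseteq> \<Union>\<U>" by blast
      then obtain \<F> where \<F>: "finite \<F>" "\<F> \<subseteq> \<U>" "K \<subseteq> \<Union>\<F>"
        using assms[OF K(1)] unfolding compactin_def \<U>_def
        by (metis (mono_tags, lifting) mem_Collect_eq)
      \<comment> \<open>A set in \<open>?K\<close> meets \<open>K\<close>, hence meets one of the
        finitely many members of \<open>\<F>\<close> covering \<open>K\<close>.\<close>
      have "?K \<subseteq> \<Union>((\<lambda>U. hitting_closed_sets X {U}) ` \<F>)"
        using K(1) \<F>(3) by (fastforce simp: hitting_closed_sets_def)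
      with \<F> show ?thesis
        by (intro exI[of _ "(\<lambda>U. hitting_closed_sets X {U}) ` \<F>"]) (auto simp: \<U>_def)
    qed
  qed
  then show ?thesis
    using sub by (simp add: compactin_subspace topspace_lower_semifinite_topology)
qed

lemma locally_compact_nbhds_lower_semifinite_topology:
  assumes "locally_compact_nbhds X"
  shows "locally_compact_nbhds (lower_semifinite_topology X)"
  unfolding locally_compact_nbhds_def neighbourhood_base_of
proof (intro allI impI, elim conjE)
  fix \<W> A
  assume \<W>: "openin (lower_semifinite_topology X) \<W>" and A: "A \<in> \<W>"
  obtain \<B> where \<B>: "lower_semifinite_base X \<B>" "A \<in> \<B>" "\<B> \<subseteq> \<W>"
    using \<W> A unfolding openin_lower_semifinite_topology union_of_def by blast
  then obtain \<Phi> where \<Phi>: "finite \<Phi>" "\<And>U. U \<in> \<Phi> \<Longrightarrow> openin X U" "\<B> = hitting_closed_sets X \<Phi>"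
    unfolding lower_semifinite_base_def by blast
  \<comment> \<open>Both sets are kept: hitting the \<open>V\<close>s will be an open condition on
    closed sets, hitting the \<open>K\<close>s a compact one.\<close>
  have "\<exists>V K. openin X V \<and> compactin X K \<and> A \<inter> V \<noteq> {} \<and> V \<subseteq> K \<and> K \<subseteq> U" if "U \<in> \<Phi>" for U
  proof -
    have "A \<inter> U \<noteq> {}" using \<B>(2) \<Phi>(3) that by (simp add: hitting_closed_sets_def)
    then obtain x where "x \<in> A" "x \<in> U" by blast
    then show ?thesis
      using assms \<Phi>(2)[OF that] unfolding locally_compact_nbhds_def neighbourhood_base_of
      by (metis IntI empty_iff)
  qed
  then obtain V K where VK: "\<And>U. U \<in> \<Phi> \<Longrightarrow>
      openin X (V U) \<and> compactin X (K U) \<and> A \<inter> V U \<noteq> {} \<and> V U \<subseteq> K U \<and> K U \<subseteq> U"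
    by metis
  have "openin (lower_semifinite_topology X) (hitting_closed_sets X (V ` \<Phi>))"
    using \<Phi>(1) VK by (intro openin_hitting_closed_sets) auto
  moreover have "compactin (lower_semifinite_topology X) (hitting_closed_sets X (K ` \<Phi>))"
    using VK by (intro compactin_hitting_closed_sets) auto
  moreover have "A \<in> hitting_closed_sets X (V ` \<Phi>)"
    using \<B>(2) \<Phi>(3) VK by (auto simp: hitting_closed_sets_def)
  moreover have "hitting_closed_sets X (V ` \<Phi>) \<subseteq> hitting_closed_sets X (K ` \<Phi>)"
    using VK by (fastforce simp: hitting_closed_sets_def)
  moreover have "hitting_closed_sets X (K ` \<Phi>) \<subseteq> \<B>"
    using VK unfolding \<Phi>(3) by (fastforce simp: hitting_closed_sets_def)
  then have "hitting_closed_sets X (K ` \<Phi>) \<subseteq> \<W>" using \<B>(3) by (rule subset_trans)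
  ultimately show "\<exists>\<U> \<V>. openin (lower_semifinite_topology X) \<U> \<and>
      compactin (lower_semifinite_topology X) \<V> \<and> A \<in> \<U> \<and> \<U> \<subseteq> \<V> \<and> \<V> \<subseteq> \<W>"
    by blast
qed

text \<open>Being nonempty amounts to hitting the open set \<open>topspace X\<close>.\<close>

lemma openin_nonempty_closed_sets:
  "openin (lower_semifinite_topology X) (nonempty_closed_sets X)"
proof -
  have "nonempty_closed_sets X = hitting_closed_sets X {topspace X}"
    by (auto simp: nonempty_closed_sets_def hitting_closed_sets_def closed_sets_def
        dest: closedin_subset)
  then show ?thesis using openin_hitting_closed_sets[of "{topspace X}" X] by simp
qed

text \<open>Failure to be a limit set is witnessed by finitely many open sets that all hit the set
  but have no common point. The same family witnesses failure for every closed set hitting its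
  members, so the complement is open.\<close>

lemma closedin_closed_limit_sets:
  "closedin (lower_semifinite_topology X) (closed_limit_sets X)"
proof -
  let ?T = "lower_semifinite_topology X"
  have "openin ?T (closed_sets X - closed_limit_sets X)"
  proof (subst openin_subopen, intro ballI)
    fix A assume "A \<in> closed_sets X - closed_limit_sets X"
    then have A: "closedin X A" "\<not> limit_set_in X A"
      by (auto simp: closed_sets_def closed_limit_sets_def)
    \<comment> \<open>If \<open>X\<close> is empty, \<open>\<Phi>\<close> may be the empty family;
      the factor \<open>topspace X\<close> covers this case.\<close>
    then obtain \<Phi> where \<Phi>: "finite \<Phi>" "\<forall>U\<in>\<Phi>. openin X U \<and> U \<inter> A \<noteq> {}"
      "topspace X \<inter> \<Inter>\<Phi> = {}"
      using closedin_subset[OF A(1)] by (auto simp: limit_set_in_iff)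
    have "openin ?T (hitting_closed_sets X \<Phi>)"
      using \<Phi> by (intro openin_hitting_closed_sets) auto
    moreover have "A \<in> hitting_closed_sets X \<Phi>"
      using A(1) \<Phi>(2) by (auto simp: hitting_closed_sets_def closed_sets_def)
    moreover have "\<not> limit_set_in X B" if "B \<in> hitting_closed_sets X \<Phi>" for B
    proof
      assume "limit_set_in X B"
      moreover have "\<forall>U\<in>\<Phi>. openin X U \<and> U \<inter> B \<noteq> {}"
        using that \<Phi>(2) by (auto simp: hitting_closed_sets_def)
      ultimately have "topspace X \<inter> \<Inter>\<Phi> \<noteq> {}"
        using \<Phi>(1) by (meson limit_set_in_iff)
      with \<Phi>(3) show False by blast
    qed
    then have "hitting_closed_sets X \<Phi> \<subseteq> closed_sets X - closed_limit_sets X"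
      by (auto simp: hitting_closed_sets_def closed_limit_sets_def)
    ultimately show "\<exists>\<U>. openin ?T \<U> \<and> A \<in> \<U> \<and> \<U> \<subseteq> closed_sets X - closed_limit_sets X"
      by blast
  qed
  moreover have "closed_limit_sets X \<subseteq> closed_sets X"
    by (auto simp: closed_limit_sets_def closed_sets_def)
  ultimately show ?thesis
    by (simp add: closedin_def topspace_lower_semifinite_topology)
qed

theorem theorem3p2:
  fixes X :: "'a topology"
  assumes "locally_compact_nbhds X"
  shows "locally_compact_nbhds (lower_semifinite_topology X) \<and>
    locally_compact_nbhds (subtopology (lower_semifinite_topology X) (nonempty_closed_sets X)) \<and>
    locally_compact_nbhds (subtopology (lower_semifinite_topology X) (closed_limit_sets X)) \<and>
    locally_compact_nbhds (subtopology (lower_semifinite_topology X) (nonempty_closed_limit_sets X))"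
proof -
  let ?T = "lower_semifinite_topology X"
  have T: "locally_compact_nbhds ?T"
    using assms by (rule locally_compact_nbhds_lower_semifinite_topology)
  have N: "locally_compact_nbhds (subtopology ?T (nonempty_closed_sets X))"
    using T openin_nonempty_closed_sets by (rule locally_compact_nbhds_open_subset)
  have L: "locally_compact_nbhds (subtopology ?T (closed_limit_sets X))"
    using T closedin_closed_limit_sets by (rule locally_compact_nbhds_closed_subset)
  \<comment> \<open>The nonempty limit sets are the intersection of an open and a closed subset, so
    they are treated as a closed subspace of the open subspace already handled.\<close>
  have "closedin (subtopology ?T (nonempty_closed_sets X))
      (nonempty_closed_sets X \<inter> closed_limit_sets X)"
    using closedin_closed_limit_sets by (rule closedin_subtopology_Int_closed)
  with N have "locally_compact_nbhds (subtopology (subtopology ?T (nonempty_closed_sets X))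
      (nonempty_closed_sets X \<inter> closed_limit_sets X))"
    by (rule locally_compact_nbhds_closed_subset)
  then have "locally_compact_nbhds (subtopology ?T (nonempty_closed_limit_sets X))"
    by (simp add: subtopology_subtopology nonempty_closed_limit_sets_def Int_ac)
  with T N L show ?thesis by blast
qed

end
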